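(* For $t\geq 5$, the $\mathrm{PAG}_t$ algorithm Flush-between-Blocks ($\mathrm{FbB}$) is $\left(t-\frac{1}{3t^2},\,2t,\,1-\frac{1}{3t^2}\right)$-competitive with respect to $(\mu_0,\mu_1)$.
   Context: Paging with Discard Predictions $\mathrm{PAG}_t$: a universe $U$ of $N>t$ pages and a cache holding $t$ pages, initially empty. An instance is $(x,\hat x,r)$ where $r=\langle r_1,\dots,r_n\rangle$ is a sequence of pages; when $r_i$ is requested (together with the prediction bit $\hat x_i$) and its page is not in cache (a fault), the algorithm must bring it into cache, evicting a page of its choice if the cache is full. Cost = number of faults. $\mathrm{LFD}$ is the optimal offline algorithm that fills the cache and on a fault with full cache evicts the page whose next request is furthest in the future. $x_i=0$ if $\mathrm{LFD}$ keeps the page of $r_i$ in cache until it is next requested (or, if never requested again, until the end), and $x_i=1$ otherwise; $\hat x_i$ predicts $x_i$. $\mu_0=\sum_i x_i(1-\hat x_i)$, $\mu_1=\sum_i(1-x_i)\hat x_i$. An algorithm is $(\alpha,\beta,\gamma)$-competitive w.r.t. $(\mu_0,\mu_1)$ if there is a constant $\kappa$ with $\mathrm{Alg}(I)\le\alpha\,\mathrm{LFD}(I)+\beta\,\mu_0(I)+\gamma\,\mu_1(I)+\kappa$ for all instances $I$. A page has prediction $b$ if the latest request to it came with prediction $b$. $\mathrm{FbB}$ partitions the input into consecutive blocks: a block starts at the beginning of the sequence or right after the previous block ends. When a block ends, the cache is flushed (emptied). On a fault with full cache that does not end the block, $\mathrm{FbB}$ evicts, among the pages in cache with prediction $1$ that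 have not already been evicted within the current block, the one that has been in cache longest. A block ends with a request causing a fault when the cache is full and either (Condition 1) all pages in cache have prediction $0$, or (Condition 2) some page in cache has prediction $1$ but every page in cache with prediction $1$ has already been evicted within the block; on this last request of the block an arbitrary page is evicted. *)

theory Defs
  imports Complex_Main
begin

text \<open>
  A run of a paging algorithm on a request sequence \<open>r\<close> is given by its list of cache contents
  \<open>C\<close>: \<open>C ! i\<close> is the cache just before request \<open>r ! i\<close> is served (indices start at 0) and
  \<open>C ! length r\<close> is the final cache.
\<close>

definition faults :: "'p list \<Rightarrow> 'p set list \<Rightarrow> nat" where
  "faults r C = card {i. i < length r \<and> r ! i \<notin> C ! i}"

text \<open>
  The first request to \<open>p\<close> at or after position \<open>i\<close>. The value \<open>length r\<close> stands for
  ``never requested again'' and is larger than every request position.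
\<close>

definition next_request :: "'p list \<Rightarrow> nat \<Rightarrow> 'p \<Rightarrow> nat" where
  "next_request r i p =
     (if \<exists>k\<ge>i. k < length r \<and> r ! k = p
      then LEAST k. i \<le> k \<and> k < length r \<and> r ! k = p
      else length r)"

definition LFD_run :: "nat \<Rightarrow> 'p list \<Rightarrow> 'p set list \<Rightarrow> bool" where
  "LFD_run t r C \<longleftrightarrow>
     length C = Suc (length r) \<and> C ! 0 = {} \<and>
     (\<forall>i < length r.
        if r ! i \<in> C ! i then C ! Suc i = C ! i
        else if card (C ! i) < t then C ! Suc i = insert (r ! i) (C ! i)
        else \<exists>p \<in> C ! i.
               (\<forall>q \<in> C ! i. next_request r (Suc i) q \<le> next_request r (Suc i) p) \<and>
               C ! Suc i = insert (r ! i) (C ! i - {p}))"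

text \<open>
  The furthest-in-the-future rule leaves ties between pages that are never requested again
  unresolved, so LFD is any function that assigns to every request sequence a run obeying
  the rule; every way of breaking ties is admitted.
\<close>

definition is_LFD :: "nat \<Rightarrow> 'p set \<Rightarrow> ('p list \<Rightarrow> 'p set list) \<Rightarrow> bool" where
  "is_LFD t U lfd \<longleftrightarrow> (\<forall>r \<in> lists U. LFD_run t r (lfd r))"

definition kept :: "'p list \<Rightarrow> 'p set list \<Rightarrow> nat \<Rightarrow> bool" where
  "kept r C i \<longleftrightarrow> (\<forall>j. i < j \<and> j \<le> next_request r (Suc i) (r ! i) \<longrightarrow> r ! i \<in> C ! j)"

definition discard_bits :: "'p list \<Rightarrow> 'p set list \<Rightarrow> bool list" where
  "discard_bits r C = map (\<lambda>i. \<not> kept r C i) [0..<length r]"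

text \<open>Instances \<open>(x, xh, r)\<close>; the bits 1 and 0 are \<open>True\<close> and \<open>False\<close>.\<close>

type_synonym 'p paging_instance = "bool list \<times> bool list \<times> 'p list"

definition PAG :: "'p set \<Rightarrow> ('p list \<Rightarrow> 'p set list) \<Rightarrow> 'p paging_instance set" where
  "PAG U lfd = {(x, xh, r). r \<in> lists U \<and> length xh = length r \<and> x = discard_bits r (lfd r)}"

fun mu0 :: "'p paging_instance \<Rightarrow> nat" where
  "mu0 (x, xh, r) = (\<Sum>i<length r. of_bool (x ! i) * (1 - of_bool (xh ! i)))"

fun mu1 :: "'p paging_instance \<Rightarrow> nat" where
  "mu1 (x, xh, r) = (\<Sum>i<length r. (1 - of_bool (x ! i)) * of_bool (xh ! i))"

fun LFD_cost :: "('p list \<Rightarrow> 'p set list) \<Rightarrow> 'p paging_instance \<Rightarrow> nat" where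
  "LFD_cost lfd (x, xh, r) = faults r (lfd r)"

definition competitive ::
  "'i set \<Rightarrow> ('i \<Rightarrow> nat) \<Rightarrow> ('i \<Rightarrow> nat) \<Rightarrow> ('i \<Rightarrow> nat) \<Rightarrow> ('i \<Rightarrow> nat) \<Rightarrow>
   real \<Rightarrow> real \<Rightarrow> real \<Rightarrow> bool" where
  "competitive Insts alg opt m0 m1 \<alpha> \<beta> \<gamma> \<longleftrightarrow>
     (\<exists>\<kappa>::real. \<forall>I \<in> Insts.
        real (alg I) \<le> \<alpha> * real (opt I) + \<beta> * real (m0 I) + \<gamma> * real (m1 I) + \<kappa>)"

text \<open>
  State of Flush-between-Blocks: the cache, listed by time of arrival with the page that has
  been in cache longest first; the prediction of the latest request to each page; the pages
  already evicted within the current block.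
\<close>

record 'p fbb_state =
  cache :: "'p list"
  pred :: "'p \<Rightarrow> bool"
  evicted :: "'p set"

definition FbB_init :: "'p fbb_state" where
  "FbB_init = \<lparr>cache = [], pred = (\<lambda>_. False), evicted = {}\<rparr>"

definition condition1 :: "'p fbb_state \<Rightarrow> bool" where
  "condition1 s \<longleftrightarrow> (\<forall>q \<in> set (cache s). \<not> pred s q)"

definition condition2 :: "'p fbb_state \<Rightarrow> bool" where
  "condition2 s \<longleftrightarrow>
     (\<exists>q \<in> set (cache s). pred s q) \<and>
     (\<forall>q \<in> set (cache s). pred s q \<longrightarrow> q \<in> evicted s)"

definition FbB_victim :: "'p fbb_state \<Rightarrow> 'p" where
  "FbB_victim s = hd (filter (\<lambda>q. pred s q \<and> q \<notin> evicted s) (cache s))"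

text \<open>
  When a block ends, the page evicted for the last request is irrelevant: the cache is
  flushed immediately afterwards, and that request has already been counted as a fault.
\<close>

definition FbB_step :: "nat \<Rightarrow> 'p fbb_state \<Rightarrow> 'p \<times> bool \<Rightarrow> 'p fbb_state" where
  "FbB_step t s = (\<lambda>(p, b).
     let pr = (pred s)(p := b) in
     if p \<in> set (cache s) then s\<lparr>pred := pr\<rparr>
     else if length (cache s) < t then s\<lparr>cache := cache s @ [p], pred := pr\<rparr>
     else if condition1 s \<or> condition2 s then \<lparr>cache = [], pred = pr, evicted = {}\<rparr>
     else \<lparr>cache = remove1 (FbB_victim s) (cache s) @ [p], pred = pr,
           evicted = insert (FbB_victim s) (evicted s)\<rparr>)"

primrec FbB_states :: "nat \<Rightarrow> 'p fbb_state \<Rightarrow> ('p \<times> bool) list \<Rightarrow> 'p fbb_state list" where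
  "FbB_states t s [] = [s]"
| "FbB_states t s (q # qs) = s # FbB_states t (FbB_step t s q) qs"

fun FbB_cost :: "nat \<Rightarrow> 'p paging_instance \<Rightarrow> nat" where
  "FbB_cost t (x, xh, r) =
     faults r (map (\<lambda>s. set (cache s)) (FbB_states t FbB_init (zip r xh)))"

end

theory Submission
  imports Defs
begin

text \<open>
  Every request \<open>i\<close> with \<open>x\<^sub>i = 1\<close> corresponds to an eviction by LFD, so LFD has at least
  \<open>\<Sum> x\<^sub>i\<close> faults, and it suffices to bound the cost of each block of FbB, adding up the bits
  \<open>x\<^sub>i\<close> inside the block. Let a block contain \<open>c\<close> correct predictions 1, \<open>m\<^sub>0\<close> and \<open>m\<^sub>1\<close> errors
  of the two kinds, and \<open>d\<close> distinct pages, and let FbB make \<open>e\<close> evictions in it before the last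
  request. Then it costs \<open>t + 1 + e\<close>. The evicted pages are distinct and had prediction 1, so
  \<open>e \<le> c + m\<^sub>1\<close> and \<open>e \<le> d\<close>. At the end of the block LFD holds all pages of the block whose latest
  request has \<open>x\<^sub>i = 0\<close>, so \<open>d \<le> t + c + m\<^sub>0\<close>.

  These inequalities suffice if \<open>m\<^sub>0 \<ge> 1\<close> or \<open>c \<ge> 2\<close>. Suppose \<open>m\<^sub>0 = 0\<close>. As \<open>d > t\<close>, some page \<open>y\<close>
  of the block has been discarded by LFD since its latest request, which is correctly predicted 1.
  If this is the only correct prediction 1, then \<open>d = t + 1\<close> and \<open>y\<close> is in the cache of FbB when
  the block ends. So the block ends by Condition 2 and \<open>y\<close> has been evicted and requested
  again. But when FbB evicted \<open>y\<close>, more than \<open>t\<close> pages had already been requested in the block, so LFD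
  had already discarded a page; this yields a second correct prediction 1.
\<close>

section \<open>Latest requests and counting over request intervals\<close>

lemma latest_request:
  fixes r :: "nat \<Rightarrow> 'p"
  assumes "p \<in> r ` {a..<k}"
  obtains i where "a \<le> i" "i < k" "r i = p" "p \<notin> r ` {i<..<k}"
proof -
  define A where "A = {i \<in> {a..<k}. r i = p}"
  have A: "finite A" "A \<noteq> {}" using assms unfolding A_def by auto
  have mem: "Max A \<in> A" using A by (rule Max_in)
  then have i: "a \<le> Max A" "Max A < k" "r (Max A) = p" unfolding A_def by auto
  have "p \<notin> r ` {Max A<..<k}"
  proof
    assume "p \<in> r ` {Max A<..<k}"
    then obtain j where "Max A < j" "j < k" "r j = p" by (auto simp: image_iff)
    moreover from this i(1) have "j \<in> A" unfolding A_def by simp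
    ultimately show False using Max_ge[OF A(1), of j] by simp
  qed
  with i show ?thesis by (rule that)
qed

definition occurrences :: "(nat \<Rightarrow> bool) \<Rightarrow> nat \<Rightarrow> nat \<Rightarrow> nat" where
  "occurrences P a k = card {i \<in> {a..<k}. P i}"

lemma occurrences_split:
  assumes "a \<le> k"
  shows "occurrences P 0 k = occurrences P 0 a + occurrences P a k"
proof -
  have "{i \<in> {0..<k}. P i} = {i \<in> {0..<a}. P i} \<union> {i \<in> {a..<k}. P i}"
    using assms by auto
  moreover have "card ({i \<in> {0..<a}. P i} \<union> {i \<in> {a..<k}. P i}) =
      card {i \<in> {0..<a}. P i} + card {i \<in> {a..<k}. P i}"
    by (rule card_Un_disjoint) auto
  ultimately show ?thesis unfolding occurrences_def by simp
qed

lemma occurrences_Suc: "occurrences P 0 (Suc k) = occurrences P 0 k + of_bool (P k)"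
proof -
  have "{i \<in> {0..<Suc k}. P i} = {i \<in> {0..<k}. P i} \<union> (if P k then {k} else {})"
    by (auto simp: less_Suc_eq)
  then show ?thesis unfolding occurrences_def by simp
qed

lemma occurrences_disj:
  assumes "\<And>i. \<not> (P i \<and> Q i)"
  shows "occurrences (\<lambda>i. P i \<or> Q i) a k = occurrences P a k + occurrences Q a k"
proof -
  have "{i \<in> {a..<k}. P i \<or> Q i} = {i \<in> {a..<k}. P i} \<union> {i \<in> {a..<k}. Q i}" by auto
  then show ?thesis
    unfolding occurrences_def using assms by (simp add: card_Un_disjoint disjoint_iff)
qed

section \<open>Arithmetic of a single block\<close>

lemma inverse_3_square_bounds:
  fixes t :: nat
  assumes "t \<ge> 5"
  shows "1 / (3 * real t ^ 2) \<le> 1 / 2" and "1 / (3 * real t ^ 2) * real t \<le> 1"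
proof -
  have "5 * 5 \<le> real t * real t" using assms by (intro mult_mono) auto
  then show "1 / (3 * real t ^ 2) \<le> 1 / 2" by (intro divide_left_mono) (auto simp: power2_eq_square)
  have "1 / (3 * real t ^ 2) * real t = 1 / (3 * real t)"
    using assms by (simp add: power2_eq_square)
  also have "\<dots> \<le> 1" using assms by simp
  finally show "1 / (3 * real t ^ 2) * real t \<le> 1" .
qed

text \<open>The two bounds on \<open>e\<close> are combined with weights \<open>1 - g\<close> and
  \<open>g\<close>: the first charges \<open>m1\<close> at rate \<open>1 - g\<close>, the second is
  free of \<open>m1\<close> and costs at most \<open>g * t \<le> 1\<close> up to small terms. The
  summands added to \<open>e\<close> on the left are the slack left for the other faults of a
  block.\<close>

lemma eviction_inequality:
  fixes t c m0 m1 e :: nat and g :: real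
  assumes t: "t \<ge> 5" and g: "g = 1 / (3 * real t ^ 2)"
    and e: "e \<le> c + m1" "e \<le> t + c + m0"
  shows "real e + (real t - 3 / 2) * real c + 2 * real t * real m0 \<le>
    (real t - g) * real (c + m0) + 2 * real t * real m0 + (1 - g) * real m1 + 1"
proof -
  have "0 \<le> g" and "g \<le> 1 / 2" and gt: "g * real t \<le> 1"
    using inverse_3_square_bounds[OF t] unfolding g by simp_all
  have "(1 - g) * (real e - real c) \<le> (1 - g) * real m1"
    using e(1) \<open>g \<le> 1 / 2\<close> by (intro mult_left_mono) linarith+
  moreover have "g * real e \<le> g * (real t + real c + real m0)"
    using e(2) \<open>0 \<le> g\<close> by (intro mult_left_mono) linarith+
  moreover have "g * real c \<le> 1 / 2 * real c"
    using \<open>g \<le> 1 / 2\<close> by (intro mult_right_mono) auto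
  moreover have "2 * g * real m0 \<le> real t * real m0"
    using \<open>g \<le> 1 / 2\<close> t by (intro mult_right_mono) auto
  ultimately show ?thesis using gt by (simp add: algebra_simps)
qed

lemma block_inequality:
  fixes t c m0 m1 e :: nat and g :: real
  assumes t: "t \<ge> 5" and g: "g = 1 / (3 * real t ^ 2)"
    and e: "e \<le> c + m1" "e \<le> t + c + m0"
    and m: "m0 \<ge> 1 \<or> c \<ge> 2"
  shows "real (t + 1 + e) \<le> (real t - g) * real (c + m0) + 2 * real t * real m0 + (1 - g) * real m1"
proof -
  have nonneg: "0 \<le> (real t - 3 / 2) * real c" "0 \<le> 2 * real t * real m0" using t by simp_all
  \<comment> \<open>The slack must pay \<open>t + 1\<close> faults and the additive 1. One error of
    the first kind gives \<open>2 * t\<close>; two correct predictions give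
    \<open>2 * t - 3\<close>, which reaches \<open>t + 2\<close> exactly when
    \<open>t \<ge> 5\<close>.\<close>
  have "real t + 2 \<le> (real t - 3 / 2) * real c + 2 * real t * real m0"
    using m
  proof
    assume "m0 \<ge> 1"
    then have "2 * real t * 1 \<le> 2 * real t * real m0" by (intro mult_left_mono) auto
    then show ?thesis using nonneg t by linarith
  next
    assume "c \<ge> 2"
    have "real t \<ge> 5" using t by simp
    moreover from \<open>c \<ge> 2\<close>
    have "(real t - 3 / 2) * 2 \<le> (real t - 3 / 2) * real c" using t by (intro mult_left_mono) auto
    ultimately show ?thesis using nonneg(2) by argo
  qed
  with eviction_inequality[OF t g e] show ?thesis by simp
qed

section \<open>Block structure of FbB\<close>

text \<open>
  All that the analysis needs to know about LFD is \<open>discards\<close>: of the pages requested in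
  \<open>{a..k}\<close>, at most \<open>t\<close> are in the cache of LFD after request \<open>k\<close>, and the others have been
  discarded after their latest request.
\<close>

locale FbB_run =
  fixes t n :: nat and r :: "nat \<Rightarrow> 'p" and x xh :: "nat \<Rightarrow> bool" and s :: "nat \<Rightarrow> 'p fbb_state"
  assumes t: "t \<ge> 5"
    and s_0: "s 0 = FbB_init"
    and s_Suc: "\<And>k. k < n \<Longrightarrow> s (Suc k) = FbB_step t (s k) (r k, xh k)"
    and discards: "\<And>a k. a \<le> k \<Longrightarrow> k < n \<Longrightarrow>
      card (r ` {a..k}) \<le> t + card {i \<in> {a..<k}. x i \<and> r i \<notin> r ` {i<..k}}"
begin

abbreviation fault :: "nat \<Rightarrow> bool" where
  "fault i \<equiv> r i \<notin> set (cache (s i))"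

abbreviation correct1 :: "nat \<Rightarrow> bool" where
  "correct1 i \<equiv> x i \<and> xh i"

abbreviation error0 :: "nat \<Rightarrow> bool" where
  "error0 i \<equiv> x i \<and> \<not> xh i"

abbreviation error1 :: "nat \<Rightarrow> bool" where
  "error1 i \<equiv> \<not> x i \<and> xh i"

text \<open>Here \<open>a\<close> is the start of the block containing time \<open>k\<close>. The
  witness \<open>j\<close> for an evicted page is the time of its eviction: more than
  \<open>t\<close> pages had been requested by then, and the page can be back in cache only through
  a later request. In the last clause, each fault of the block so far either lengthens the cache or
  evicts a new page.\<close>

definition block_inv :: "nat \<Rightarrow> nat \<Rightarrow> bool" where
  "block_inv a k \<longleftrightarrow>
     a \<le> k \<and> distinct (cache (s k)) \<and> length (cache (s k)) \<le> t \<and>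
     set (cache (s k)) \<subseteq> r ` {a..<k} \<and>
     (\<forall>i. a \<le> i \<and> i < k \<and> r i \<notin> r ` {i<..<k} \<longrightarrow> pred (s k) (r i) = xh i) \<and>
     evicted (s k) \<subseteq> r ` {i \<in> {a..<k}. xh i} \<and>
     (\<forall>q \<in> evicted (s k). \<exists>j. a \<le> j \<and> j < k \<and> t < card (r ` {a..j}) \<and>
        (q \<in> set (cache (s k)) \<longrightarrow> q \<in> r ` {j<..<k})) \<and>
     occurrences fault 0 k =
       occurrences fault 0 a + length (cache (s k)) + card (evicted (s k))"

lemma block_invD:
  assumes "block_inv a k"
  shows "a \<le> k" and "distinct (cache (s k))" and "length (cache (s k)) \<le> t"
    and "set (cache (s k)) \<subseteq> r ` {a..<k}"
    and "\<forall>i. a \<le> i \<and> i < k \<and> r i \<notin> r ` {i<..<k} \<longrightarrow> pred (s k) (r i) = xh i"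
    and "evicted (s k) \<subseteq> r ` {i \<in> {a..<k}. xh i}"
    and "\<forall>q \<in> evicted (s k). \<exists>j. a \<le> j \<and> j < k \<and> t < card (r ` {a..j}) \<and>
        (q \<in> set (cache (s k)) \<longrightarrow> q \<in> r ` {j<..<k})"
    and "occurrences fault 0 k =
       occurrences fault 0 a + length (cache (s k)) + card (evicted (s k))"
  using assms unfolding block_inv_def by blast+

lemma card_distinct_pages:
  assumes "a \<le> k" "k < n"
  shows "card (r ` {a..k}) \<le> t + occurrences x a (Suc k)"
proof -
  have "card {i \<in> {a..<k}. x i \<and> r i \<notin> r ` {i<..k}} \<le> occurrences x a (Suc k)"
    unfolding occurrences_def by (rule card_mono) auto
  with discards[OF assms] show ?thesis by linarith
qed

lemma occurrences_x: "occurrences x a k = occurrences correct1 a k + occurrences error0 a k"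
proof -
  have "x = (\<lambda>i. correct1 i \<or> error0 i)" by auto
  then show ?thesis using occurrences_disj[of correct1 error0 a k] by (simp cong: conj_cong)
qed

lemma occurrences_xh: "occurrences xh a k = occurrences correct1 a k + occurrences error1 a k"
proof -
  have "xh = (\<lambda>i. correct1 i \<or> error1 i)" by auto
  then show ?thesis using occurrences_disj[of correct1 error1 a k] by (simp cong: conj_cong)
qed

lemma discarded_page:
  assumes "a \<le> k" "k < n" "t < card (r ` {a..k})"
  obtains i where "a \<le> i" "i < k" "x i" "r i \<notin> r ` {i<..k}"
proof -
  have "{i \<in> {a..<k}. x i \<and> r i \<notin> r ` {i<..k}} \<noteq> {}"
    using discards[OF assms(1,2)] assms(3) by (metis add.right_neutral card.empty not_le)
  then show ?thesis using that by auto
qed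

lemma fault_full_card:
  assumes "block_inv a k" "fault k" "\<not> length (cache (s k)) < t"
  shows "t < card (r ` {a..k})"
proof -
  have "insert (r k) (set (cache (s k))) \<subseteq> r ` {a..k}"
    using assms(1) unfolding block_inv_def by force
  then have "card (insert (r k) (set (cache (s k)))) \<le> card (r ` {a..k})"
    by (intro card_mono) auto
  moreover have "card (set (cache (s k))) = length (cache (s k))"
    using assms(1) unfolding block_inv_def by (simp add: distinct_card)
  ultimately show ?thesis using assms(2,3) by simp
qed

lemma evicted_bounds:
  assumes "block_inv a k" "k \<le> n"
  shows "card (evicted (s k)) \<le> occurrences correct1 a k + occurrences error1 a k"
    and "card (evicted (s k)) \<le> t + occurrences correct1 a k + occurrences error0 a k"
proof -
  let ?I = "{i \<in> {a..<k}. xh i}"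
  have sub: "evicted (s k) \<subseteq> r ` ?I" using assms(1) unfolding block_inv_def by blast
  have "card (evicted (s k)) \<le> card (r ` ?I)" using sub by (intro card_mono) auto
  also have "\<dots> \<le> occurrences xh a k" unfolding occurrences_def by (intro card_image_le) auto
  finally show "card (evicted (s k)) \<le> occurrences correct1 a k + occurrences error1 a k"
    by (simp add: occurrences_xh)
  show "card (evicted (s k)) \<le> t + occurrences correct1 a k + occurrences error0 a k"
  \<comment> \<open>\<open>card_distinct_pages\<close> speaks of closed intervals, so a nonempty
    block is rewritten to end at \<open>k - 1\<close>.\<close>
  proof (cases "a < k")
    case True
    then obtain j where j: "k = Suc j" "a \<le> j" by (cases k) auto
    have "card (evicted (s k)) \<le> card (r ` {a..j})"
      using sub j by (intro card_mono) (auto simp: less_Suc_eq_le)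
    also have "\<dots> \<le> t + occurrences x a k"
      using card_distinct_pages[of a j] j assms(2) by auto
    finally show ?thesis by (simp add: occurrences_x)
  next
    case False
    then have "evicted (s k) = {}" using sub by auto
    then show ?thesis by simp
  qed
qed

lemma two_correct_predictions:
  assumes inv: "block_inv a b" and b: "b < n" "fault b" "\<not> length (cache (s b)) < t"
    and "end": "condition1 (s b) \<or> condition2 (s b)"
    and m0: "occurrences error0 a (Suc b) = 0"
  shows "2 \<le> occurrences correct1 a (Suc b)"
proof (rule ccontr)
  assume "\<not> ?thesis"
  with m0 have one: "occurrences x a (Suc b) \<le> 1" by (simp add: occurrences_x)
  have "card {i \<in> {a..<Suc b}. x i} \<le> Suc 0"
    using one unfolding occurrences_def by simp
  then have uniq: "i = j" if "x i" "x j" "a \<le> i" "i \<le> b" "a \<le> j" "j \<le> b" for i j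
    using that by (auto simp: card_le_Suc0_iff_eq)
  have no_error0: "xh i" if "x i" "a \<le> i" "i \<le> b" for i
    using m0 that unfolding occurrences_def by (auto simp: card_eq_0_iff)
  have ab: "a \<le> b" using inv unfolding block_inv_def by simp
  have big: "t < card (r ` {a..b})" using fault_full_card[OF inv b(2,3)] .
  obtain i where i: "a \<le> i" "i < b" "x i" "r i \<notin> r ` {i<..b}"
    using discarded_page[OF ab b(1) big] .
  \<comment> \<open>With a single discard the block has no pages beyond the \<open>t\<close> cached
    ones and the faulting one, which forces the discarded page into the cache of FbB.\<close>
  have "card (r ` {a..b}) \<le> Suc t"
    using card_distinct_pages[OF ab b(1)] one by linarith
  moreover have "card (insert (r b) (set (cache (s b)))) = Suc (length (cache (s b)))"
    using inv b(2) unfolding block_inv_def by (simp add: distinct_card)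
  moreover have "insert (r b) (set (cache (s b))) \<subseteq> r ` {a..b}"
    using inv unfolding block_inv_def by force
  ultimately have "insert (r b) (set (cache (s b))) = r ` {a..b}"
    using b(3) by (intro card_seteq) auto
  then have "r i \<in> insert (r b) (set (cache (s b)))" using i by auto
  then have ri: "r i \<in> set (cache (s b))" using i by auto
  have "pred (s b) (r i) = xh i" using inv i unfolding block_inv_def by auto
  then have "pred (s b) (r i)" using no_error0 i by auto
  \<comment> \<open>A cached page with prediction 1 rules out \<open>condition1\<close>, so the
    block ends by \<open>condition2\<close>.\<close>
  with ri "end" have "r i \<in> evicted (s b)"
    unfolding condition1_def condition2_def by auto
  then obtain j where j: "a \<le> j" "j < b" "t < card (r ` {a..j})" "r i \<in> r ` {j<..<b}"
    using inv ri unfolding block_inv_def by blast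
  \<comment> \<open>The discard already forced at time \<open>j\<close> must be the one at
    \<open>i\<close>, by uniqueness; but the page was requested again after \<open>j\<close>, so
    \<open>i\<close> was not its latest request.\<close>
  obtain i' where i': "a \<le> i'" "i' < j" "x i'"
    using discarded_page[OF j(1) _ j(3)] j(2) b(1) by auto
  then have "i' = i" using uniq i j by auto
  with i' i(4) j(4) show False by auto
qed

lemma block_inv_step:
  assumes inv: "block_inv a k" and k: "k < n"
    and "continue": "\<not> (fault k \<and> \<not> length (cache (s k)) < t \<and> (condition1 (s k) \<or> condition2 (s k)))"
  shows "block_inv a (Suc k)"
proof -
  note invD = block_invD[OF inv]
  have pred: "pred (s (Suc k)) = (pred (s k))(r k := xh k)"
    using s_Suc[OF k] unfolding FbB_step_def by (auto simp: Let_def)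
  have pred_inv: "pred (s (Suc k)) (r i) = xh i"
    if "a \<le> i" "i < Suc k" "r i \<notin> r ` {i<..<Suc k}" for i
  proof (cases "i = k")
    case True
    then show ?thesis using pred by simp
  next
    case False
    then have "i < k" using that by auto
    then have "r i \<noteq> r k" "r i \<notin> r ` {i<..<k}" using that by force+
    then show ?thesis using pred invD(5) that(1) \<open>i < k\<close> by auto
  qed
  have fin: "finite (evicted (s k))"
  proof (rule finite_subset)
    show "evicted (s k) \<subseteq> r ` {i \<in> {a..<k}. xh i}" using invD(6) .
  qed simp
  consider (hit) "\<not> fault k" | (fill) "fault k" "length (cache (s k)) < t"
    | (evict) "fault k" "\<not> length (cache (s k)) < t" "\<not> condition1 (s k)" "\<not> condition2 (s k)"
    using "continue" by blast
  then show ?thesis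
  proof cases
    case hit
    have st: "cache (s (Suc k)) = cache (s k)" "evicted (s (Suc k)) = evicted (s k)"
      using s_Suc[OF k] hit unfolding FbB_step_def by (auto simp: Let_def)
    have ev: "\<exists>j. a \<le> j \<and> j < Suc k \<and> t < card (r ` {a..j}) \<and>
        (q \<in> set (cache (s k)) \<longrightarrow> q \<in> r ` {j<..<Suc k})" if q: "q \<in> evicted (s k)" for q
    proof -
      obtain j where "a \<le> j" "j < k" "t < card (r ` {a..j})"
        "q \<in> set (cache (s k)) \<longrightarrow> q \<in> r ` {j<..<k}"
        using bspec[OF invD(7) q] by blast
      then show ?thesis by (intro exI[of _ j]) auto
    qed
    have "set (cache (s k)) \<subseteq> r ` {a..<Suc k}" using invD(4) by force
    moreover have "evicted (s k) \<subseteq> r ` {i \<in> {a..<Suc k}. xh i}" using invD(6) by force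
    ultimately show ?thesis
      unfolding block_inv_def st
      using invD pred_inv ev hit by (simp add: occurrences_Suc)
  next
    case fill
    have st: "cache (s (Suc k)) = cache (s k) @ [r k]" "evicted (s (Suc k)) = evicted (s k)"
      using s_Suc[OF k] fill unfolding FbB_step_def by (auto simp: Let_def)
    have ev: "\<exists>j. a \<le> j \<and> j < Suc k \<and> t < card (r ` {a..j}) \<and>
        (q \<in> set (cache (s k) @ [r k]) \<longrightarrow> q \<in> r ` {j<..<Suc k})" if q: "q \<in> evicted (s k)" for q
    proof -
      obtain j where "a \<le> j" "j < k" "t < card (r ` {a..j})"
        "q \<in> set (cache (s k)) \<longrightarrow> q \<in> r ` {j<..<k}"
        using bspec[OF invD(7) q] by blast
      then show ?thesis by (intro exI[of _ j]) auto
    qed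
    have "set (cache (s k) @ [r k]) \<subseteq> r ` {a..<Suc k}" using invD(1,4) by force
    moreover have "evicted (s k) \<subseteq> r ` {i \<in> {a..<Suc k}. xh i}" using invD(6) by force
    ultimately show ?thesis
      unfolding block_inv_def st
      using invD pred_inv ev fill by (simp add: occurrences_Suc)
  next
    case evict
    define v where "v = FbB_victim (s k)"
    have st: "cache (s (Suc k)) = remove1 v (cache (s k)) @ [r k]"
        "evicted (s (Suc k)) = insert v (evicted (s k))"
      using s_Suc[OF k] evict unfolding FbB_step_def v_def by (auto simp: Let_def)
    \<comment> \<open>Failure of both conditions makes this list nonempty, so the \<open>hd\<close>
      in \<open>FbB_victim\<close> is a genuine page.\<close>
    have "filter (\<lambda>q. pred (s k) q \<and> q \<notin> evicted (s k)) (cache (s k)) \<noteq> []"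
      using evict unfolding condition1_def condition2_def by (auto simp: filter_empty_conv)
    from hd_in_set[OF this] have v: "v \<in> set (cache (s k))" "pred (s k) v" "v \<notin> evicted (s k)"
      unfolding v_def FbB_victim_def by auto
    \<comment> \<open>The prediction of \<open>v\<close> stems from its latest request, which lies
      in the current block, so its eviction is charged to a prediction 1 of this block.\<close>
    have "v \<in> r ` {a..<k}" using v invD(4) by blast
    then obtain i where i: "a \<le> i" "i < k" "r i = v" "v \<notin> r ` {i<..<k}"
      by (rule latest_request)
    then have "xh i" using invD(5) v by blast
    then have "v \<in> r ` {i \<in> {a..<Suc k}. xh i}" using i by force
    moreover have "evicted (s k) \<subseteq> r ` {i \<in> {a..<Suc k}. xh i}" using invD(6) by force
    ultimately have ev_sub: "insert v (evicted (s k)) \<subseteq> r ` {i \<in> {a..<Suc k}. xh i}" by blast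
    have big: "t < card (r ` {a..k})" using fault_full_card[OF inv evict(1,2)] .
    have cache_set: "set (remove1 v (cache (s k)) @ [r k]) = insert (r k) (set (cache (s k)) - {v})"
      using invD(2) by auto
    have ev: "\<exists>j. a \<le> j \<and> j < Suc k \<and> t < card (r ` {a..j}) \<and>
        (q \<in> set (remove1 v (cache (s k)) @ [r k]) \<longrightarrow> q \<in> r ` {j<..<Suc k})"
      if q: "q \<in> insert v (evicted (s k))" for q
    proof (cases "q = v")
      case True
      then have "q \<notin> set (remove1 v (cache (s k)) @ [r k])"
        unfolding cache_set using v evict by auto
      \<comment> \<open>The victim leaves the cache now, so \<open>k\<close> itself is the witness;
        earlier evictions keep theirs, since a page entering now is requested at
        \<open>k > j\<close>.\<close>
      then show ?thesis using invD(1) big by (intro exI[of _ k]) auto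
    next
      case False
      then obtain j where "a \<le> j" "j < k" "t < card (r ` {a..j})"
        "q \<in> set (cache (s k)) \<longrightarrow> q \<in> r ` {j<..<k}"
        using bspec[OF invD(7), of q] q by blast
      then show ?thesis unfolding cache_set by (intro exI[of _ j]) auto
    qed
    have "set (remove1 v (cache (s k)) @ [r k]) \<subseteq> r ` {a..<Suc k}"
      unfolding cache_set using invD(1,4) by force
    moreover have "length (remove1 v (cache (s k)) @ [r k]) = length (cache (s k))"
      using v by (simp add: length_remove1) (metis Suc_pred length_pos_if_in_set)
    moreover have "distinct (remove1 v (cache (s k)) @ [r k])"
      using invD(2) evict(1) by auto
    moreover have "card (insert v (evicted (s k))) = Suc (card (evicted (s k)))"
      using v fin by simp
    ultimately show ?thesis
      unfolding block_inv_def st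
      using invD pred_inv ev ev_sub evict(1) by (simp add: occurrences_Suc del: set_append)
  qed
qed

lemma block_inv_flush:
  assumes k: "k < n" and flush: "fault k" "\<not> length (cache (s k)) < t"
    "condition1 (s k) \<or> condition2 (s k)"
  shows "block_inv (Suc k) (Suc k)"
proof -
  have "cache (s (Suc k)) = []" "evicted (s (Suc k)) = {}"
    using s_Suc[OF k] flush unfolding FbB_step_def by (auto simp: Let_def)
  then show ?thesis unfolding block_inv_def by auto
qed

text \<open>The competitive bound with the cost of LFD replaced by its number of discards, which
  makes it additive over blocks.\<close>

definition bound :: "nat \<Rightarrow> nat \<Rightarrow> real" where
  "bound a k =
     (real t - 1 / (3 * real t ^ 2)) * real (occurrences correct1 a k + occurrences error0 a k)
     + 2 * real t * real (occurrences error0 a k)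
     + (1 - 1 / (3 * real t ^ 2)) * real (occurrences error1 a k)"

lemma bound_split: "a \<le> k \<Longrightarrow> bound 0 k = bound 0 a + bound a k"
  unfolding bound_def by (simp add: occurrences_split[of a k] algebra_simps)

text \<open>Completed blocks are paid for without any additive constant; only the block still open
  at \<open>k\<close> remains unpaid.\<close>

lemma block_decomposition:
  "k \<le> n \<Longrightarrow> \<exists>a. block_inv a k \<and> real (occurrences fault 0 a) \<le> bound 0 a"
proof (induction k)
  case 0
  have "block_inv 0 0" unfolding block_inv_def s_0 FbB_init_def by simp
  moreover have "bound 0 0 = 0" "occurrences fault 0 0 = 0"
    unfolding bound_def occurrences_def by simp_all
  ultimately show ?case by (metis of_nat_0 order_refl)
next
  case (Suc k)
  then obtain a where a: "block_inv a k" "real (occurrences fault 0 a) \<le> bound 0 a" by auto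
  have k: "k < n" using Suc by simp
  show ?case
  proof (cases "fault k \<and> \<not> length (cache (s k)) < t \<and> (condition1 (s k) \<or> condition2 (s k))")
    case False
    then show ?thesis using block_inv_step[OF a(1) k] a(2) by blast
  next
    case True
    let ?e = "card (evicted (s k))"
    have ak: "a \<le> k" "length (cache (s k)) = t"
      and count: "occurrences fault 0 k = occurrences fault 0 a + t + ?e"
      using a(1) True unfolding block_inv_def by auto
    have mono: "occurrences P a k \<le> occurrences P a (Suc k)" for P
      unfolding occurrences_def by (rule card_mono) auto
    have e: "?e \<le> occurrences correct1 a (Suc k) + occurrences error1 a (Suc k)"
      "?e \<le> t + occurrences correct1 a (Suc k) + occurrences error0 a (Suc k)"
      using evicted_bounds[OF a(1)] k mono[of correct1] mono[of error1] mono[of error0]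
      by linarith+
    have m: "occurrences error0 a (Suc k) \<ge> 1 \<or> occurrences correct1 a (Suc k) \<ge> 2"
      using two_correct_predictions[OF a(1) k] True by fastforce
    have "real (t + 1 + ?e) \<le> bound a (Suc k)"
      unfolding bound_def by (rule block_inequality[OF t refl e m])
    moreover have "occurrences fault 0 (Suc k) = occurrences fault 0 a + (t + 1 + ?e)"
      using count True by (simp add: occurrences_Suc)
    ultimately have "real (occurrences fault 0 (Suc k)) \<le> bound 0 (Suc k)"
      using a(2) bound_split[of a "Suc k"] ak(1) by simp
    then show ?thesis using block_inv_flush k True by blast
  qed
qed

lemma faults_bound: "real (occurrences fault 0 n) \<le> bound 0 n + real (t + 1)"
proof -
  obtain a where a: "block_inv a n" "real (occurrences fault 0 a) \<le> bound 0 a"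
    using block_decomposition by blast
  let ?l = "length (cache (s n))" and ?e = "card (evicted (s n))"
  have an: "a \<le> n" "?l \<le> t" "occurrences fault 0 n = occurrences fault 0 a + ?l + ?e"
    using a(1) unfolding block_inv_def by auto
  have "real (?l + ?e) \<le> bound a n + real (t + 1)"
  proof -
    have "0 \<le> (real t - 3 / 2) * real (occurrences correct1 a n)"
      "0 \<le> 2 * real t * real (occurrences error0 a n)"
      using t by simp_all
    then show ?thesis
      using eviction_inequality[OF t refl evicted_bounds[OF a(1) order_refl]] an(2)
      unfolding bound_def by linarith
  qed
  then show ?thesis using a(2) an bound_split[of a n] by simp
qed

end

section \<open>States of FbB, next requests and runs of LFD\<close>

lemma FbB_states_nth:
  "k \<le> length qs \<Longrightarrow> FbB_states t s qs ! k = foldl (FbB_step t) s (take k qs)"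
proof (induction qs arbitrary: s k)
  case Nil
  then show ?case by simp
next
  case (Cons q qs)
  then show ?case by (cases k) auto
qed

lemma length_FbB_states: "length (FbB_states t s qs) = Suc (length qs)"
  by (induction qs arbitrary: s) auto

lemma next_request_le_length: "next_request r i p \<le> length r"
proof (cases "\<exists>k\<ge>i. k < length r \<and> r ! k = p")
  case True
  then obtain k where k: "i \<le> k \<and> k < length r \<and> r ! k = p" by blast
  have "(LEAST k. i \<le> k \<and> k < length r \<and> r ! k = p) \<le> k" using k by (rule Least_le)
  with True k show ?thesis unfolding next_request_def by auto
qed (auto simp: next_request_def)

lemma next_request_le:
  assumes "i \<le> k" "k < length r" "r ! k = p"
  shows "next_request r i p \<le> k"
proof -
  have "(LEAST k. i \<le> k \<and> k < length r \<and> r ! k = p) \<le> k" using assms by (intro Least_le) auto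
  with assms show ?thesis unfolding next_request_def by auto
qed

lemma next_request_ge:
  assumes "k \<le> length r" "p \<notin> (!) r ` {i..<k}"
  shows "k \<le> next_request r i p"
proof (cases "\<exists>k\<ge>i. k < length r \<and> r ! k = p")
  case True
  then have "i \<le> next_request r i p \<and> next_request r i p < length r \<and> r ! next_request r i p = p"
    unfolding next_request_def using LeastI_ex[of "\<lambda>k. i \<le> k \<and> k < length r \<and> r ! k = p"] by auto
  then show ?thesis using assms(2) by (metis atLeastLessThan_iff image_eqI not_le)
qed (use assms in \<open>auto simp: next_request_def\<close>)

lemma LFD_run_Suc:
  assumes "LFD_run t r C" "i < length r"
  shows "r ! i \<in> C ! Suc i"
    and "r ! i \<in> C ! i \<Longrightarrow> C ! Suc i = C ! i"
    and "p \<in> C ! i \<Longrightarrow> q \<in> C ! i \<Longrightarrow> p \<notin> C ! Suc i \<Longrightarrow> q \<notin> C ! Suc i \<Longrightarrow> p = q"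
  using assms unfolding LFD_run_def by (auto split: if_splits)

lemma LFD_run_card:
  assumes "LFD_run t r C" "t > 0"
  shows "i \<le> length r \<Longrightarrow> finite (C ! i) \<and> card (C ! i) \<le> t"
proof (induction i)
  case 0
  then show ?case using assms unfolding LFD_run_def by auto
next
  case (Suc i)
  have IH: "finite (C ! i)" "card (C ! i) \<le> t" using Suc by auto
  have "i < length r" using Suc.prems by simp
  from assms(1)[unfolded LFD_run_def, THEN conjunct2, THEN conjunct2, rule_format, OF this]
  show ?case
    using IH assms(2) by (auto split: if_splits simp: card_insert_if)
qed

text \<open>A page of the interval missing from the cache after request \<open>k\<close> was lost
  since its latest request and before its next one, so that request is not \<open>kept\<close>.
  Mapping such pages to their latest requests gives the count.\<close>

lemma LFD_run_discards:
  assumes run: "LFD_run t r C" and t: "t > 0" and k: "a \<le> k" "k < length r"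
  shows "card ((!) r ` {a..k}) \<le>
    t + card {i \<in> {a..<k}. \<not> kept r C i \<and> r ! i \<notin> (!) r ` {i<..k}}" (is "_ \<le> _ + card ?W")
proof -
  have C: "finite (C ! Suc k)" "card (C ! Suc k) \<le> t"
    using LFD_run_card[OF run t, of "Suc k"] k by auto
  have "(!) r ` {a..k} - C ! Suc k \<subseteq> (!) r ` ?W"
  proof
    fix p assume p: "p \<in> (!) r ` {a..k} - C ! Suc k"
    then have "p \<in> (!) r ` {a..<Suc k}" by (auto simp: less_Suc_eq_le)
    then obtain i where i: "a \<le> i" "i < Suc k" "r ! i = p" "p \<notin> (!) r ` {i<..<Suc k}"
      by (rule latest_request)
    \<comment> \<open>The page requested at \<open>k\<close> is in cache right afterwards, hence
      \<open>?W\<close> stops before \<open>k\<close>.\<close>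
    have "i \<noteq> k" using p i LFD_run_Suc(1)[OF run k(2)] by auto
    moreover have "Suc k \<le> next_request r (Suc i) p"
      using i k by (intro next_request_ge) auto
    then have "\<not> kept r C i" unfolding kept_def using p i by auto
    ultimately show "p \<in> (!) r ` ?W" using i by (force simp: less_Suc_eq_le)
  qed
  then have "card ((!) r ` {a..k} - C ! Suc k) \<le> card ((!) r ` ?W)"
    by (intro card_mono) auto
  also have "\<dots> \<le> card ?W" by (intro card_image_le) auto
  finally have "card ((!) r ` {a..k} - C ! Suc k) \<le> card ?W" .
  moreover have "card ((!) r ` {a..k}) \<le> card ((!) r ` {a..k} - C ! Suc k) + card (C ! Suc k)"
    using card_Un_le[of "(!) r ` {a..k} - C ! Suc k" "C ! Suc k"]
      card_mono[of "((!) r ` {a..k} - C ! Suc k) \<union> C ! Suc k" "(!) r ` {a..k}"] C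
    by fastforce
  ultimately show ?thesis using C by linarith
qed

text \<open>The first time after \<open>i\<close> at which the page is missing is the successor of
  the eviction time \<open>j\<close>. No request to the page lies strictly between \<open>i\<close>
  and \<open>j\<close>, so \<open>j\<close> and the page determine \<open>i\<close>.\<close>

lemma not_kept_eviction:
  assumes run: "LFD_run t r C" and i: "i < length r" "\<not> kept r C i"
  obtains j where "i < j" "j < length r" "r ! j \<notin> C ! j" "r ! i \<in> C ! j" "r ! i \<notin> C ! Suc j"
    "r ! i \<notin> (!) r ` {i<..<j}"
proof -
  let ?P = "\<lambda>j. i < j \<and> j \<le> next_request r (Suc i) (r ! i) \<and> r ! i \<notin> C ! j"
  obtain j0 where j0: "?P j0" using i(2) unfolding kept_def by blast
  define m where "m = (LEAST j. ?P j)"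
  have m: "?P m" unfolding m_def by (rule LeastI[of ?P, OF j0])
  have "m \<noteq> Suc i" using m LFD_run_Suc(1)[OF run i(1)] by auto
  with m obtain j where j: "m = Suc j" "i < j" by (cases m) auto
  have jn: "j < length r"
    using m j next_request_le_length[of r "Suc i" "r ! i"] by simp
  have "\<not> ?P j" using not_less_Least[of j ?P] j m_def by auto
  then have in_j: "r ! i \<in> C ! j" using m j by auto
  have "r ! j \<notin> C ! j" using LFD_run_Suc(2)[OF run jn] in_j m j by auto
  moreover have "r ! i \<notin> (!) r ` {i<..<j}"
  proof
    assume "r ! i \<in> (!) r ` {i<..<j}"
    then obtain l where "i < l" "l < j" "r ! l = r ! i" by auto
    then have "next_request r (Suc i) (r ! i) \<le> l" using jn by (intro next_request_le) auto
    then show False using m j \<open>l < j\<close> by auto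
  qed
  ultimately show ?thesis using that[of j] j jn in_j m by auto
qed

text \<open>Each discard is charged to the fault that evicts its page. This is injective: a fault
  evicts only one page, and the discard is the latest request to that page before the fault.\<close>

lemma discards_le_faults:
  assumes run: "LFD_run t r C"
  shows "occurrences (\<lambda>i. \<not> kept r C i) 0 (length r) \<le> faults r C"
proof -
  let ?Q = "\<lambda>i j. i < j \<and> j < length r \<and> r ! j \<notin> C ! j \<and> r ! i \<in> C ! j \<and> r ! i \<notin> C ! Suc j \<and>
    r ! i \<notin> (!) r ` {i<..<j}"
  let ?A = "{i \<in> {0..<length r}. \<not> kept r C i}"
  have "\<forall>i\<in>?A. \<exists>j. ?Q i j"
    using not_kept_eviction[OF run] by (metis (no_types, lifting) atLeastLessThan_iff mem_Collect_eq)
  from bchoice[OF this] obtain f where f: "\<forall>i\<in>?A. ?Q i (f i)" ..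
  have "inj_on f ?A"
  proof (rule inj_onI, rule ccontr)
    fix i i' assume A: "i \<in> ?A" "i' \<in> ?A" and eq: "f i = f i'" and ne: "i \<noteq> i'"
    have Q: "?Q i (f i)" "?Q i' (f i)" using f A eq by auto
    then have same: "r ! i = r ! i'" using LFD_run_Suc(3)[OF run, of "f i"] by blast
    from ne have "i' \<in> {i<..<f i} \<or> i \<in> {i'<..<f i}" using Q by auto
    then have "r ! i \<in> (!) r ` {i<..<f i} \<or> r ! i' \<in> (!) r ` {i'<..<f i}"
      by (metis same imageI)
    then show False using Q by blast
  qed
  moreover have "f ` ?A \<subseteq> {i. i < length r \<and> r ! i \<notin> C ! i}" using f by auto
  ultimately show ?thesis
    unfolding occurrences_def faults_def by (intro card_inj_on_le) auto
qed

section \<open>Transfer to instances and competitiveness\<close>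

lemma sum_bits_eq_occurrences:
  "(\<Sum>i<n. of_bool (P i) * (1 - of_bool (Q i)) :: nat) = occurrences (\<lambda>i. P i \<and> \<not> Q i) 0 n"
proof (induction n)
  case 0
  then show ?case by (simp add: occurrences_def)
next
  case (Suc n)
  then show ?case by (simp add: occurrences_Suc)
qed

theorem theorem64:
  fixes U :: "'p set" and t :: nat and lfd :: "'p list \<Rightarrow> 'p set list"
  assumes "t \<ge> 5"
    and "finite U" and "card U > t"
    and "is_LFD t U lfd"
  shows "competitive (PAG U lfd) (FbB_cost t) (LFD_cost lfd) mu0 mu1
           (real t - 1 / (3 * real t ^ 2)) (2 * real t) (1 - 1 / (3 * real t ^ 2))"
  unfolding competitive_def
proof (intro exI[of _ "real (t + 1)"] ballI)
  fix I assume "I \<in> PAG U lfd"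
  then obtain x xh r where I: "I = (x, xh, r)" "r \<in> lists U" "length xh = length r"
    "x = discard_bits r (lfd r)"
    unfolding PAG_def by auto
  have run: "LFD_run t r (lfd r)" using assms(4) I(2) unfolding is_LFD_def by blast
  have x: "x ! i \<longleftrightarrow> \<not> kept r (lfd r) i" if "i < length r" for i
    using that I(4) unfolding discard_bits_def by simp
  define y where "y = (\<lambda>i. \<not> kept r (lfd r) i)"
  define s where "s = (\<lambda>k. foldl (FbB_step t) FbB_init (take k (zip r xh)))"
  interpret FbB_run t "length r" "(!) r" y "(!) xh" s
  proof
    show "t \<ge> 5" by fact
    show "s 0 = FbB_init" unfolding s_def by simp
    show "s (Suc k) = FbB_step t (s k) (r ! k, xh ! k)" if "k < length r" for k
      unfolding s_def using that I(3) by (simp add: take_Suc_conv_app_nth)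
    show "card ((!) r ` {a..k}) \<le> t + card {i \<in> {a..<k}. y i \<and> r ! i \<notin> (!) r ` {i<..k}}"
      if "a \<le> k" "k < length r" for a k
      unfolding y_def using LFD_run_discards[OF run _ that] assms(1) by simp
  qed
  have cost: "FbB_cost t I = occurrences fault 0 (length r)"
    unfolding I(1) FbB_cost.simps faults_def occurrences_def s_def
    using I(3) by (intro arg_cong[where f = card]) (auto simp: FbB_states_nth length_FbB_states)
  have m0: "mu0 I = occurrences error0 0 (length r)"
    using sum_bits_eq_occurrences[of y "(!) xh" "length r"] x unfolding I(1) y_def by simp
  have m1: "mu1 I = occurrences error1 0 (length r)"
    using sum_bits_eq_occurrences[of "(!) xh" y "length r"] x
    unfolding I(1) y_def by (simp add: mult.commute conj_commute)
  have "occurrences correct1 0 (length r) + occurrences error0 0 (length r) \<le> LFD_cost lfd I"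
    using discards_le_faults[OF run] occurrences_x[of 0 "length r"] unfolding I(1) y_def by simp
  \<comment> \<open>Discards may be replaced by the larger cost of LFD because their coefficient is
    nonnegative.\<close>
  moreover have "0 \<le> real t - 1 / (3 * real t ^ 2)"
    using inverse_3_square_bounds(1)[OF assms(1)] assms(1) by linarith
  ultimately have
    "(real t - 1 / (3 * real t ^ 2)) *
       real (occurrences correct1 0 (length r) + occurrences error0 0 (length r))
     \<le> (real t - 1 / (3 * real t ^ 2)) * real (LFD_cost lfd I)"
    by (intro mult_left_mono) auto
  then show "real (FbB_cost t I) \<le> (real t - 1 / (3 * real t ^ 2)) * real (LFD_cost lfd I)
      + 2 * real t * real (mu0 I) + (1 - 1 / (3 * real t ^ 2)) * real (mu1 I) + real (t + 1)"
    using faults_bound unfolding bound_def cost m0 m1 by linarith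
qed

end
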